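(* Consider the proof system consisting of the axioms and rules listed in the context together with the Right-Weakening rule WR: from $\vdash A$ infer $\vdash A,B$. (i) Soundness: every sequent derivable in this system is valid in every projective Q-structure under every assignment. (ii) Completeness: every formula $x$ such that $1$ belongs to the interpretation of $x$ in every projective Q-structure under every assignment is such that $\vdash x$ is derivable in this system.
   Context: A Q-structure is a tuple $\langle \mathcal P,\mathcal Z,\cdot,1\rangle$ where $\mathcal P$ is a set, $\mathcal Z\subseteq\mathcal P$, $\cdot$ is a binary operation on $\mathcal P$ (not assumed associative or commutative), and $1\in\mathcal P$. These satisfy, for all $x,y,z$: (a) $x\cdot y\in\mathcal Z$ iff $y\cdot x\in\mathcal Z$; (b) $(x\cdot y)\cdot z\in\mathcal Z$ iff $x\cdot(z\cdot y)\in\mathcal Z$; and $1\cdot x=x\cdot1=x$. It is projective if for every $x\in\mathcal Z$ and every $y\in\mathcal P$ one has $x\cdot y\in\mathcal Z$. For $A\subseteq\mathcal P$ let $A^\perp=\{b: b\cdot a\in\mathcal Z\ \forall a\in A\}$. A fact is a set $F$ with $F=(F^\perp)^\perp$. Let $A\cdot B=\{a\cdot b: a\in A,b\in B\}$. Operations on facts: - $\sim F=F^\perp$; - $F\otimes G=((F\cdot G)^\perp)^\perp$; - $F\wp G=(F^\perp\cdot G^\perp)^\perp$; - $F\&G=F\cap G$; - $F\oplus G=((F\cup G)^\perp)^\perp$. Formulas are built from propositional letters $a$, their negations $\sim a$, and the constants $\mathbf1,\top,\sim\mathbf1,\sim\top$, using $\otimes,\wp,\&,\oplus$. Negation of compound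 formulas is defined by De Morgan duality: $\sim(A\otimes B)=\sim A\wp\sim B$, $\sim(A\wp B)=\sim A\otimes\sim B$, $\sim(A\&B)=\sim A\oplus\sim B$, $\sim(A\oplus B)=\sim A\&\sim B$, and $\sim\sim A=A$. An assignment gives each letter a fact, and formulas are interpreted as facts: $\mathbf1$ as $\mathcal Z^\perp$, $\top$ as $\mathcal P$, and the connectives by the operations above. A sequent $\vdash A_1,\dots,A_n$ is valid iff $1$ belongs to the interpretation of $(\cdots(A_1\wp A_2)\wp\cdots)\wp A_n$, associated to the left. Axioms and rules ($A,B,C,D$ formulas, $\sigma$ a finite sequence of formulas): - Logical axiom: $\vdash\sim A,A$. - Cut: from $\vdash A,B$ and $\vdash\sim A,C$ infer $\vdash B,C$. - Exchange1: from $\vdash A_1,A_2$ infer $\vdash A_2,A_1$. - Exchange2: from $\vdash A_1,A_2,A_3$ infer $\vdash A_3,A_2,A_1$. - Axiom $\top$: $\vdash\top,A$. - $\&$: from $\vdash A,C$ and $\vdash B,C$ infer $\vdash A\&B,C$. - $\oplus1$: from $\vdash A,C$ infer $\vdash A\oplus B,C$. - $\oplus2$: from $\vdash A,C$ infer $\vdash B\oplus A,C$. - Axiom1: $\vdash\mathbf1$. - $\bot$: from $\vdash A$ infer $\vdash\sim\mathbf1,A$. - $\otimes$: from $\vdash A,C$ and $\vdash B,D$ infer $\vdash C,D,A\otimes B$. - $\wp$: from $\vdash A,B,\sigma$ infer $\vdash A\wp B,\sigma$.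
   Formalization: In Cut, axiom ⊤, &, ⊕1, ⊕2 and ⊗ each side formula may also be absent (Cut's conclusion must be nonempty); with mandatory side formulas, completeness fails: ⊤ is valid, but ⊢⊤ is not derivable. *)

theory Defs
  imports Main
begin

section \<open>Q-structures\<close>

record 'p qstruct =
  points :: "'p set"
  zeros :: "'p set"
  mul :: "'p \<Rightarrow> 'p \<Rightarrow> 'p"
  unit :: 'p

locale Q_structure =
  fixes Q :: "'p qstruct"
  assumes zeros_subset: "zeros Q \<subseteq> points Q"
    and mul_closed: "\<lbrakk>x \<in> points Q; y \<in> points Q\<rbrakk> \<Longrightarrow> mul Q x y \<in> points Q"
    and unit_closed: "unit Q \<in> points Q"
    and zeros_commute:
      "\<lbrakk>x \<in> points Q; y \<in> points Q\<rbrakk> \<Longrightarrow> mul Q x y \<in> zeros Q \<longleftrightarrow> mul Q y x \<in> zeros Q"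
    and zeros_assoc:
      "\<lbrakk>x \<in> points Q; y \<in> points Q; z \<in> points Q\<rbrakk> \<Longrightarrow>
        mul Q (mul Q x y) z \<in> zeros Q \<longleftrightarrow> mul Q x (mul Q z y) \<in> zeros Q"
    and unit_left: "x \<in> points Q \<Longrightarrow> mul Q (unit Q) x = x"
    and unit_right: "x \<in> points Q \<Longrightarrow> mul Q x (unit Q) = x"

locale projective_Q_structure = Q_structure +
  assumes projective: "\<lbrakk>x \<in> zeros Q; y \<in> points Q\<rbrakk> \<Longrightarrow> mul Q x y \<in> zeros Q"

definition perp :: "'p qstruct \<Rightarrow> 'p set \<Rightarrow> 'p set" where
  "perp Q A = {b \<in> points Q. \<forall>a\<in>A. mul Q b a \<in> zeros Q}"

definition is_fact :: "'p qstruct \<Rightarrow> 'p set \<Rightarrow> bool" where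
  "is_fact Q F \<longleftrightarrow> F \<subseteq> points Q \<and> F = perp Q (perp Q F)"

definition set_mul :: "'p qstruct \<Rightarrow> 'p set \<Rightarrow> 'p set \<Rightarrow> 'p set" where
  "set_mul Q A B = {mul Q a b | a b. a \<in> A \<and> b \<in> B}"

definition tensor_fact :: "'p qstruct \<Rightarrow> 'p set \<Rightarrow> 'p set \<Rightarrow> 'p set" where
  "tensor_fact Q F G = perp Q (perp Q (set_mul Q F G))"

definition par_fact :: "'p qstruct \<Rightarrow> 'p set \<Rightarrow> 'p set \<Rightarrow> 'p set" where
  "par_fact Q F G = perp Q (set_mul Q (perp Q F) (perp Q G))"

definition with_fact :: "'p qstruct \<Rightarrow> 'p set \<Rightarrow> 'p set \<Rightarrow> 'p set" where
  "with_fact Q F G = F \<inter> G"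

definition plus_fact :: "'p qstruct \<Rightarrow> 'p set \<Rightarrow> 'p set \<Rightarrow> 'p set" where
  "plus_fact Q F G = perp Q (perp Q (F \<union> G))"


section \<open>Formulas and their interpretation\<close>

text \<open>
  Formulas are in negation normal form: negation is primitive on letters and constants only.
\<close>

datatype 'a fm =
    Letter 'a
  | NegLetter 'a
  | One
  | NegOne
  | Top
  | NegTop
  | Tensor "'a fm" "'a fm"
  | Par "'a fm" "'a fm"
  | With "'a fm" "'a fm"
  | Plus "'a fm" "'a fm"

primrec neg :: "'a fm \<Rightarrow> 'a fm" where
  "neg (Letter a) = NegLetter a"
| "neg (NegLetter a) = Letter a"
| "neg One = NegOne"
| "neg NegOne = One"
| "neg Top = NegTop"
| "neg NegTop = Top"
| "neg (Tensor A B) = Par (neg A) (neg B)"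
| "neg (Par A B) = Tensor (neg A) (neg B)"
| "neg (With A B) = Plus (neg A) (neg B)"
| "neg (Plus A B) = With (neg A) (neg B)"

definition assignment :: "'p qstruct \<Rightarrow> ('a \<Rightarrow> 'p set) \<Rightarrow> bool" where
  "assignment Q V \<longleftrightarrow> (\<forall>a. is_fact Q (V a))"

primrec interp :: "'p qstruct \<Rightarrow> ('a \<Rightarrow> 'p set) \<Rightarrow> 'a fm \<Rightarrow> 'p set" where
  "interp Q V (Letter a) = V a"
| "interp Q V (NegLetter a) = perp Q (V a)"
| "interp Q V One = perp Q (zeros Q)"
| "interp Q V NegOne = perp Q (perp Q (zeros Q))"
| "interp Q V Top = points Q"
| "interp Q V NegTop = perp Q (points Q)"
| "interp Q V (Tensor A B) = tensor_fact Q (interp Q V A) (interp Q V B)"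
| "interp Q V (Par A B) = par_fact Q (interp Q V A) (interp Q V B)"
| "interp Q V (With A B) = with_fact Q (interp Q V A) (interp Q V B)"
| "interp Q V (Plus A B) = plus_fact Q (interp Q V A) (interp Q V B)"

text \<open>
  Sequents are nonempty lists of formulas; the empty list counts as not valid.
\<close>

definition valid :: "'p qstruct \<Rightarrow> ('a \<Rightarrow> 'p set) \<Rightarrow> 'a fm list \<Rightarrow> bool" where
  "valid Q V \<Gamma> \<longleftrightarrow> \<Gamma> \<noteq> [] \<and> unit Q \<in> interp Q V (foldl Par (hd \<Gamma>) (tl \<Gamma>))"


section \<open>The proof system with right weakening\<close>

text \<open>
  A side position of a rule holds one formula or is vacant. The vacant case is essential: if every
  side position had to be filled, a one-formula sequent could only be concluded by the axiom for
  \<open>One\<close> or by the rule for \<open>Par\<close>, so that not even the valid sequent \<open>[Top]\<close> would be derivable.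
\<close>

definition side :: "'a fm list \<Rightarrow> bool" where
  "side \<Gamma> \<longleftrightarrow> length \<Gamma> \<le> 1"

inductive derivable :: "'a fm list \<Rightarrow> bool" where
  Logical: "derivable [neg A, A]"
| Cut: "\<lbrakk>derivable (A # \<Gamma>); derivable (neg A # \<Delta>); side \<Gamma>; side \<Delta>; \<Gamma> @ \<Delta> \<noteq> []\<rbrakk> \<Longrightarrow>
    derivable (\<Gamma> @ \<Delta>)"
| Exchange1: "derivable [A\<^sub>1, A\<^sub>2] \<Longrightarrow> derivable [A\<^sub>2, A\<^sub>1]"
| Exchange2: "derivable [A\<^sub>1, A\<^sub>2, A\<^sub>3] \<Longrightarrow> derivable [A\<^sub>3, A\<^sub>2, A\<^sub>1]"
| TopR: "side \<Gamma> \<Longrightarrow> derivable (Top # \<Gamma>)"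
| WithR: "\<lbrakk>derivable (A # \<Gamma>); derivable (B # \<Gamma>); side \<Gamma>\<rbrakk> \<Longrightarrow> derivable (With A B # \<Gamma>)"
| Plus1: "\<lbrakk>derivable (A # \<Gamma>); side \<Gamma>\<rbrakk> \<Longrightarrow> derivable (Plus A B # \<Gamma>)"
| Plus2: "\<lbrakk>derivable (A # \<Gamma>); side \<Gamma>\<rbrakk> \<Longrightarrow> derivable (Plus B A # \<Gamma>)"
| OneR: "derivable [One]"
| BotR: "derivable [A] \<Longrightarrow> derivable [NegOne, A]"
| TensorR: "\<lbrakk>derivable (A # \<Gamma>); derivable (B # \<Delta>); side \<Gamma>; side \<Delta>\<rbrakk> \<Longrightarrow>
    derivable (\<Gamma> @ \<Delta> @ [Tensor A B])"
| ParR: "derivable (A # B # \<sigma>) \<Longrightarrow> derivable (Par A B # \<sigma>)"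
| WR: "derivable [A] \<Longrightarrow> derivable [A, B]"

end

theory Submission
  imports Defs "HOL-Library.Countable"
begin

text \<open>
  Completeness uses a syntactic model: points are formulas over the letters of \<open>x\<close>, the product is
  the tensor made strictly unital at \<open>One\<close>, and \<open>a\<close> is a zero iff \<open>neg a\<close> is derivable; a formula
  \<open>A\<close> is then interpreted by \<open>{b. derivable [neg b, A]}\<close>. Although cuts into three-formula sequents
  are not available, cutting against \<open>Par (Tensor (neg A) (neg B)) B, A\<close> yields the residuation law
  that passes from \<open>Par A B, C\<close> to \<open>A, Par C B\<close>, which gives both Q-structure axioms and the
  invertibility of \<open>Par\<close>. Tensors with \<open>One\<close> are not special semantically: the formula \<open>With A A\<close>
  is equivalent to \<open>A\<close> and distinct from \<open>One\<close>, so the strict unit does no harm.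
\<close>

section \<open>Soundness\<close>

context Q_structure
begin

lemma perp_subset: "perp Q A \<subseteq> points Q"
  by (auto simp: perp_def)

lemma mem_perp_iff: "b \<in> perp Q A \<longleftrightarrow> b \<in> points Q \<and> (\<forall>a \<in> A. mul Q b a \<in> zeros Q)"
  by (simp add: perp_def)

lemma perp_antimono: "A \<subseteq> B \<Longrightarrow> perp Q B \<subseteq> perp Q A"
  by (auto simp: perp_def)

lemma subset_perp_perp: "A \<subseteq> points Q \<Longrightarrow> A \<subseteq> perp Q (perp Q A)"
  unfolding perp_def using zeros_commute by blast

lemma perp_perp_perp: "A \<subseteq> points Q \<Longrightarrow> perp Q (perp Q (perp Q A)) = perp Q A"
  by (meson perp_antimono perp_subset subset_antisym subset_perp_perp)

lemma is_fact_perp: "A \<subseteq> points Q \<Longrightarrow> is_fact Q (perp Q A)"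
  by (simp add: is_fact_def perp_perp_perp perp_subset)

text \<open>Double \<open>perp\<close> is a closure operator whose closed sets are the facts, so
  inclusion of a closure in a fact can be tested on its generators.\<close>

lemma perp_perp_subset_iff:
  assumes "A \<subseteq> points Q" "is_fact Q F"
  shows "perp Q (perp Q A) \<subseteq> F \<longleftrightarrow> A \<subseteq> F"
  using assms by (metis is_fact_def perp_antimono subset_perp_perp subset_trans)

lemma set_mul_subset: "A \<subseteq> points Q \<Longrightarrow> B \<subseteq> points Q \<Longrightarrow> set_mul Q A B \<subseteq> points Q"
  using mul_closed by (auto simp: set_mul_def)

lemma mem_factI:
  assumes "is_fact Q F" "x \<in> points Q" "\<And>y. y \<in> perp Q F \<Longrightarrow> mul Q x y \<in> zeros Q"
  shows "x \<in> F"
  using assms unfolding is_fact_def by (metis mem_perp_iff)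

lemma mul_perp_zero:
  assumes "x \<in> F" "is_fact Q F" "y \<in> perp Q F"
  shows "mul Q x y \<in> zeros Q" "mul Q y x \<in> zeros Q"
proof -
  have "x \<in> perp Q (perp Q F)" "x \<in> points Q" "y \<in> points Q"
    using assms unfolding is_fact_def by (blast, blast, simp add: mem_perp_iff)
  then show "mul Q x y \<in> zeros Q" "mul Q y x \<in> zeros Q"
    using assms zeros_commute by (blast dest: mem_perp_iff[THEN iffD1])+
qed

lemma perp_Un: "perp Q (A \<union> B) = perp Q A \<inter> perp Q B"
  by (auto simp: perp_def)

text \<open>An intersection of facts is the \<open>perp\<close> of the union of their perps, and
  every \<open>perp\<close> is a fact.\<close>

lemma is_fact_Int:
  assumes "is_fact Q F" "is_fact Q G"
  shows "is_fact Q (F \<inter> G)"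
proof -
  have "F \<inter> G = perp Q (perp Q F \<union> perp Q G)"
    using assms by (simp add: perp_Un is_fact_def)
  then show ?thesis
    using is_fact_perp[of "perp Q F \<union> perp Q G"] perp_subset by simp
qed

lemma is_fact_points: "is_fact Q (points Q)"
  by (meson is_fact_def perp_subset subset_antisym subset_perp_perp subset_refl)

section \<open>Facts denoted by formulas, and when they contain the unit\<close>

lemma is_fact_interp:
  assumes "assignment Q V"
  shows "is_fact Q (interp Q V A)"
proof (induction A)
  case (Letter a)
  then show ?case using assms by (simp add: assignment_def)
next
  case (NegLetter a)
  have "V a \<subseteq> points Q"
    using assms unfolding assignment_def is_fact_def by blast
  then show ?case by (simp add: is_fact_perp)
next
  case (Tensor A B)
  then show ?case
    by (simp add: tensor_fact_def is_fact_perp perp_subset)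
next
  case (Par A B)
  then show ?case
    by (simp add: par_fact_def is_fact_perp perp_subset set_mul_subset)
next
  case (With A B)
  then show ?case by (simp add: with_fact_def is_fact_Int)
next
  case (Plus A B)
  then show ?case by (simp add: plus_fact_def is_fact_perp perp_subset)
qed (simp_all add: is_fact_points is_fact_perp zeros_subset perp_subset)

text \<open>The operations on facts satisfy the De Morgan laws by which \<open>neg\<close> is
  defined. Closures that pile up collapse because three perps equal one and a fact is its own double
  \<open>perp\<close>.\<close>

lemma interp_neg:
  assumes V: "assignment Q V"
  shows "interp Q V (neg A) = perp Q (interp Q V A)"
proof (induction A)
  case (NegLetter a)
  then show ?case using V by (auto simp: assignment_def is_fact_def)
next
  case One
  then show ?case by simp
next
  case NegOne
  then show ?case by (simp add: perp_perp_perp zeros_subset)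
next
  case NegTop
  then show ?case using is_fact_points by (simp add: is_fact_def)
next
  case (Tensor A B)
  have "perp Q (perp Q (interp Q V A)) = interp Q V A" for A
    using is_fact_interp[OF V, of A] by (simp add: is_fact_def)
  moreover have "interp Q V A \<subseteq> points Q" for A
    using is_fact_interp[OF V, of A] by (simp add: is_fact_def)
  ultimately show ?case using Tensor
    by (simp add: tensor_fact_def par_fact_def perp_perp_perp set_mul_subset)
next
  case (Par A B)
  then show ?case by (simp add: tensor_fact_def par_fact_def)
next
  case (With A B)
  have "perp Q (perp Q (interp Q V A)) = interp Q V A" for A
    using is_fact_interp[OF V, of A] by (simp add: is_fact_def)
  then show ?case using With by (simp add: with_fact_def plus_fact_def perp_Un)
next
  case (Plus A B)
  have "interp Q V A \<union> interp Q V B \<subseteq> points Q"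
    using is_fact_interp[OF V] by (simp add: is_fact_def)
  from perp_perp_perp[OF this] show ?case using Plus
    by (simp add: with_fact_def plus_fact_def perp_Un)
qed simp_all

text \<open>Multiplying by the unit changes nothing, so the left side says that
  \<open>perp Q F\<close> is orthogonal to \<open>perp Q G\<close>. For a fact \<open>G\<close> this
  is an inclusion, the semantic form of an implication.\<close>

lemma unit_in_par_iff:
  assumes "is_fact Q G"
  shows "unit Q \<in> par_fact Q F G \<longleftrightarrow> perp Q F \<subseteq> G"
proof -
  have "unit Q \<in> par_fact Q F G \<longleftrightarrow>
      (\<forall>a \<in> perp Q F. \<forall>b \<in> perp Q G. mul Q (unit Q) (mul Q a b) \<in> zeros Q)"
    using unit_closed by (auto simp: par_fact_def set_mul_def mem_perp_iff[of "unit Q"])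
  also have "\<dots> \<longleftrightarrow> (\<forall>a \<in> perp Q F. \<forall>b \<in> perp Q G. mul Q a b \<in> zeros Q)"
    using perp_subset by (metis mul_closed subsetD unit_left)
  also have "\<dots> \<longleftrightarrow> perp Q F \<subseteq> G"
    using assms by (meson mem_factI mul_perp_zero(1) perp_subset subset_iff)
  finally show ?thesis .
qed

lemma unit_in_fact_iff:
  assumes "is_fact Q F"
  shows "unit Q \<in> F \<longleftrightarrow> perp Q F \<subseteq> zeros Q"
proof
  assume "unit Q \<in> F"
  then show "perp Q F \<subseteq> zeros Q"
    using assms mul_perp_zero(1) perp_subset by (metis subset_iff unit_left)
next
  assume "perp Q F \<subseteq> zeros Q"
  then show "unit Q \<in> F"
    using assms by (metis (full_types) mem_factI perp_subset subset_iff unit_closed unit_left)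
qed

section \<open>Validity of short sequents as membership and inclusion\<close>

lemma valid_single: "valid Q V [A] \<longleftrightarrow> unit Q \<in> interp Q V A"
  by (simp add: valid_def)

lemma valid_pair:
  assumes "assignment Q V"
  shows "valid Q V [A, B] \<longleftrightarrow> interp Q V (neg A) \<subseteq> interp Q V B"
  using assms by (simp add: valid_def unit_in_par_iff is_fact_interp interp_neg)

text \<open>Association to the left makes this a pair with first formula \<open>Par A B\<close>. The
  negation of that formula denotes the closure of the product set, which lies in a fact exactly when
  the product set does.\<close>

lemma valid_triple:
  assumes V: "assignment Q V"
  shows "valid Q V [A, B, C] \<longleftrightarrow>
    set_mul Q (interp Q V (neg A)) (interp Q V (neg B)) \<subseteq> interp Q V C"
proof -
  have "valid Q V [A, B, C] \<longleftrightarrow> perp Q (interp Q V (Par A B)) \<subseteq> interp Q V C"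
    using V by (simp add: valid_def unit_in_par_iff is_fact_interp del: interp.simps(8))
      (simp add: unit_in_par_iff is_fact_interp)
  then show ?thesis
    using perp_perp_subset_iff[OF set_mul_subset[OF perp_subset perp_subset] is_fact_interp[OF V]]
    by (simp add: interp_neg V par_fact_def)
qed

lemma valid_exchange:
  assumes V: "assignment Q V" and "valid Q V [A, B]"
  shows "valid Q V [B, A]"
  using assms is_fact_interp[OF V, of A]
  by (simp add: valid_pair interp_neg) (metis is_fact_def perp_antimono)

text \<open>This is where \<open>zeros_assoc\<close> enters: \<open>(c b) a\<close> is a zero
  exactly when \<open>c (a b)\<close> is, so the outer two factors can trade places.\<close>

lemma valid_exchange3:
  assumes V: "assignment Q V" and ABC: "valid Q V [A, B, C]"
  shows "valid Q V [C, B, A]"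
proof -
  have "mul Q c b \<in> interp Q V A"
    if c: "c \<in> perp Q (interp Q V C)" and b: "b \<in> perp Q (interp Q V B)" for b c
  proof (rule mem_factI[OF is_fact_interp[OF V]])
    have pts: "b \<in> points Q" "c \<in> points Q"
      using b c perp_subset by blast+
    then show "mul Q c b \<in> points Q" by (rule mul_closed[OF _ _, rotated])
    fix a assume a: "a \<in> perp Q (interp Q V A)"
    then have ap: "a \<in> points Q" using perp_subset by blast
    have "mul Q a b \<in> interp Q V C"
      using ABC a b by (auto simp: valid_triple V interp_neg set_mul_def)
    then have "mul Q c (mul Q a b) \<in> zeros Q"
      using mul_perp_zero(2) c is_fact_interp[OF V] by blast
    then show "mul Q (mul Q c b) a \<in> zeros Q"
      using zeros_assoc pts ap by blast
  qed
  then show ?thesis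
    by (auto simp: valid_triple V interp_neg set_mul_def)
qed

end

section \<open>Soundness of the rules\<close>

lemma side_cases:
  assumes "side \<Gamma>"
  obtains "\<Gamma> = []" | C where "\<Gamma> = [C]"
  using assms by (cases \<Gamma>) (auto simp: side_def)

lemma neg_neg [simp]: "neg (neg A) = A"
  by (induction A) auto

text \<open>By induction on the derivation. Exchanging a side formula to the front turns a pair into
  an inclusion into the fact of the principal formula; a vacant side position turns it into
  membership of the unit.\<close>

lemma (in projective_Q_structure) soundness:
  assumes der: "derivable \<Gamma>" and V: "assignment Q V"
  shows "valid Q V \<Gamma>"
  using der
proof induction
  note fact = is_fact_interp[OF V]
  note int_simps = valid_single valid_pair[OF V] valid_triple[OF V]
  have nn: "perp Q (perp Q (interp Q V A)) = interp Q V A" for A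
    using fact[of A] by (simp add: is_fact_def)
  have pts: "interp Q V A \<subseteq> points Q" for A
    using fact[of A] by (simp add: is_fact_def)
  {
    case (Logical A)
    then show ?case by (simp add: int_simps)
  next
    case (Cut A \<Gamma> \<Delta>)
    then show ?case
    proof (cases rule: side_cases[OF Cut(3)]; cases rule: side_cases[OF Cut(4)])
      fix C assume *: "\<Gamma> = [C]" "\<Delta> = []"
      have "valid Q V [C, A]" using Cut.IH(1) * valid_exchange[OF V] by simp
      moreover have "unit Q \<in> interp Q V (neg A)" using Cut.IH(2) * by (simp add: int_simps)
      ultimately have "unit Q \<in> interp Q V C"
        using Cut.IH(1) * by (auto simp: int_simps)
      then show ?case using * by (simp add: int_simps)
    next
      fix C D assume *: "\<Gamma> = [C]" "\<Delta> = [D]"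
      have "valid Q V [C, A]" using Cut.IH(1) * valid_exchange[OF V] by simp
      then show ?case using * Cut.IH(2) by (auto simp: int_simps)
    qed (use Cut in \<open>auto simp: int_simps\<close>)
  next
    case (Exchange1 A B)
    then show ?case using valid_exchange V by blast
  next
    case (Exchange2 A B C)
    then show ?case using valid_exchange3 V by blast
  next
    case (TopR \<Gamma>)
    show ?case
    proof (cases rule: side_cases[OF TopR])
      case 1
      then show ?thesis using unit_closed by (simp add: int_simps)
    next
      case (2 C)
      then show ?thesis
        \<comment> \<open>\<open>NegTop\<close> denotes the least fact, since the
          \<open>perp\<close> of all points lies in every double \<open>perp\<close>.\<close>
        using perp_antimono[of "perp Q (interp Q V C)" "points Q"] perp_subset
        by (simp add: int_simps nn)
    qed
  next
    case (WithR A \<Gamma> B)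
    show ?case
    proof (cases rule: side_cases[OF WithR(3)])
      case 1
      then show ?thesis using WithR.IH by (simp add: int_simps with_fact_def)
    next
      case (2 C)
      have "valid Q V [C, A]" "valid Q V [C, B]"
        using WithR.IH valid_exchange[OF V] 2 by simp_all
      then have "valid Q V [C, With A B]"
        by (simp add: int_simps with_fact_def)
      then show ?thesis using valid_exchange[OF V] 2 by simp
    qed
  next
    case (Plus1 A \<Gamma> B)
    have sub: "interp Q V A \<subseteq> interp Q V (Plus A B)"
      using subset_perp_perp[of "interp Q V A \<union> interp Q V B"] pts by (simp add: plus_fact_def)
    show ?case
    proof (cases rule: side_cases[OF Plus1(2)])
      case 1
      then show ?thesis using Plus1.IH sub by (auto simp: int_simps simp del: interp.simps)
    next
      case (2 C)
      then have "valid Q V [C, A]" using Plus1.IH valid_exchange[OF V] by simp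
      then have "valid Q V [C, Plus A B]"
        using sub by (auto simp: int_simps simp del: interp.simps)
      then show ?thesis using valid_exchange[OF V] 2 by simp
    qed
  next
    case (Plus2 A \<Gamma> B)
    have sub: "interp Q V A \<subseteq> interp Q V (Plus B A)"
      using subset_perp_perp[of "interp Q V B \<union> interp Q V A"] pts by (simp add: plus_fact_def)
    show ?case
    proof (cases rule: side_cases[OF Plus2(2)])
      case 1
      then show ?thesis using Plus2.IH sub by (auto simp: int_simps simp del: interp.simps)
    next
      case (2 C)
      then have "valid Q V [C, A]" using Plus2.IH valid_exchange[OF V] by simp
      then have "valid Q V [C, Plus B A]"
        using sub by (auto simp: int_simps simp del: interp.simps)
      then show ?thesis using valid_exchange[OF V] 2 by simp
    qed
  next
    case OneR
    then show ?case
      using unit_closed zeros_subset unit_left by (auto simp: int_simps perp_def)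
  next
    case (BotR A)
    then have "perp Q (interp Q V A) \<subseteq> zeros Q"
      by (simp add: int_simps unit_in_fact_iff fact)
    from perp_antimono[OF this] show ?case by (simp add: int_simps nn)
  next
    case (TensorR A \<Gamma> B \<Delta>)
    have mul: "mul Q a b \<in> interp Q V (Tensor A B)"
      if "a \<in> interp Q V A" "b \<in> interp Q V B" for a b
      using subset_perp_perp[OF set_mul_subset[OF pts pts], of A B] that
      by (auto simp: tensor_fact_def set_mul_def)
    have left: "interp Q V (neg C) \<subseteq> interp Q V A" if "\<Gamma> = [C]" for C
      using TensorR.IH(1) valid_exchange[OF V, of A C] that by (simp flip: valid_pair[OF V])
    have right: "interp Q V (neg D) \<subseteq> interp Q V B" if "\<Delta> = [D]" for D
      using TensorR.IH(2) valid_exchange[OF V, of B D] that by (simp flip: valid_pair[OF V])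
    show ?case
    \<comment> \<open>A filled side position supplies an arbitrary element of the fact of its
      negation as a factor; a vacant one supplies the unit.\<close>
    proof (cases rule: side_cases[OF TensorR(3)]; cases rule: side_cases[OF TensorR(4)])
      assume *: "\<Gamma> = []" "\<Delta> = []"
      then have "mul Q (unit Q) (unit Q) \<in> interp Q V (Tensor A B)"
        using TensorR.IH by (intro mul) (auto simp: int_simps)
      then show ?case using * unit_left[OF unit_closed] by (simp add: int_simps)
    next
      fix D assume *: "\<Gamma> = []" "\<Delta> = [D]"
      have "d \<in> interp Q V (Tensor A B)" if "d \<in> interp Q V (neg D)" for d
      proof -
        have "d \<in> points Q" "d \<in> interp Q V B" "unit Q \<in> interp Q V A"
          using TensorR.IH(1) * right[OF *(2)] that pts by (auto simp: int_simps)
        then show ?thesis using mul[of "unit Q" d] unit_left by metis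
      qed
      then show ?case using * by (auto simp: int_simps simp del: interp.simps)
    next
      fix C assume *: "\<Gamma> = [C]" "\<Delta> = []"
      have "c \<in> interp Q V (Tensor A B)" if "c \<in> interp Q V (neg C)" for c
      proof -
        have "c \<in> points Q" "c \<in> interp Q V A" "unit Q \<in> interp Q V B"
          using TensorR.IH(2) * left[OF *(1)] that pts by (auto simp: int_simps)
        then show ?thesis using mul[of c "unit Q"] unit_right by metis
      qed
      then show ?case using * by (auto simp: int_simps simp del: interp.simps)
    next
      fix C D assume *: "\<Gamma> = [C]" "\<Delta> = [D]"
      have "set_mul Q (interp Q V (neg C)) (interp Q V (neg D)) \<subseteq> interp Q V (Tensor A B)"
        using mul left[OF *(1)] right[OF *(2)] by (auto simp: set_mul_def simp del: interp.simps)
      then show ?case using * by (simp add: int_simps del: interp.simps)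
    qed
  next
    case (ParR A B \<sigma>)
    then show ?case by (simp add: valid_def)
  next
    case (WR A B)
    \<comment> \<open>By projectivity, zeros are orthogonal to every point and hence belong to every
      fact, in particular to that of \<open>B\<close>.\<close>
    then have A: "perp Q (interp Q V A) \<subseteq> zeros Q"
      by (simp add: int_simps unit_in_fact_iff fact)
    have "a \<in> interp Q V B" if "a \<in> perp Q (interp Q V A)" for a
    proof (rule mem_factI[OF fact])
      show "a \<in> points Q" using that perp_subset by blast
      show "mul Q a y \<in> zeros Q" if "y \<in> perp Q (interp Q V B)" for y
        using that \<open>a \<in> perp Q (interp Q V A)\<close> A perp_subset projective[of a y] by blast
    qed
    then show ?case by (auto simp: valid_pair V interp_neg)
  }
qed


section \<open>Residuation\<close>

lemma side_Nil [simp]: "side []" and side_single [simp]: "side [A]"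
  by (simp_all add: side_def)

lemma Cut2: "derivable [A, C] \<Longrightarrow> derivable [neg A, D] \<Longrightarrow> derivable [C, D]"
  using Cut[of A "[C]" "[D]"] by simp

lemma derivable_pair_commute: "derivable [A, B] \<longleftrightarrow> derivable [B, A]"
  using Exchange1 by blast

lemma derivable_trans: "derivable [A, B] \<Longrightarrow> derivable [neg B, C] \<Longrightarrow> derivable [A, C]"
  using Cut2 Exchange1 by blast

lemma Tensor2:
  "derivable [A, C] \<Longrightarrow> derivable [B, D] \<Longrightarrow> derivable [C, D, Tensor A B]"
  using TensorR[of A "[C]" B "[D]"] by simp

lemma Tensor_mono:
  "derivable [C, A] \<Longrightarrow> derivable [D, B] \<Longrightarrow> derivable [Par C D, Tensor A B]"
  using Tensor2 ParR Exchange1 by blast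

text \<open>The cut formula pairs \<open>Tensor (neg A) (neg B)\<close>, which the hypothesis lets
  \<open>C\<close> replace, with a copy of \<open>B\<close>. Packing the pair into one
  \<open>Par\<close> keeps both premises of the cut at two formulas.\<close>

lemma residuation:
  assumes "derivable [Par A B, C]"
  shows "derivable [A, Par C B]"
proof (rule Cut2)
  show "derivable [Par (Tensor (neg A) (neg B)) B, A]"
    using Exchange2[OF Tensor2[OF Logical Logical]] by (rule ParR)
  show "derivable [neg (Par (Tensor (neg A) (neg B)) B), Par C B]"
    using Exchange1[OF ParR[OF Tensor2[OF assms Logical]]] by simp
qed

text \<open>Swapping \<open>A\<close> and \<open>C\<close> swaps the two sides up to exchange, so
  \<open>residuation\<close> gives both directions.\<close>

lemma residuation_iff: "derivable [Par A B, C] \<longleftrightarrow> derivable [A, Par C B]"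
  using residuation derivable_pair_commute by blast

lemma derivable_NegOne: "derivable [NegOne, A] \<longleftrightarrow> derivable [A]"
  using BotR Cut[of One "[]" "[A]"] OneR by auto

text \<open>To invert \<open>ParR\<close>, add \<open>NegOne\<close> as a second formula, residuate
  so that it joins \<open>B\<close>, and cut it away again, since \<open>Par NegOne B\<close>
  implies \<open>B\<close>.\<close>

lemma derivable_Par: "derivable [Par A B] \<longleftrightarrow> derivable [A, B]"
proof
  assume "derivable [Par A B]"
  then have "derivable [A, Par NegOne B]"
    by (intro residuation Exchange1[OF BotR])
  moreover have "derivable [neg (Par NegOne B), B]"
    using TensorR[of One "[]" "neg B" "[B]"] OneR Logical[of B]
    by (simp add: derivable_pair_commute[of _ B])
  ultimately show "derivable [A, B]"
    by (rule derivable_trans)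
qed (rule ParR)

lemma derivable_With: "derivable [C, With A B] \<longleftrightarrow> derivable [C, A] \<and> derivable [C, B]"
proof
  assume *: "derivable [C, With A B]"
  have "derivable [neg (With A B), A]" "derivable [neg (With A B), B]"
    using Plus1[OF Logical] Plus2[OF Logical] by simp_all
  then show "derivable [C, A] \<and> derivable [C, B]"
    using * derivable_trans by blast
next
  assume "derivable [C, A] \<and> derivable [C, B]"
  then show "derivable [C, With A B]"
    using WithR[of A "[C]" B] Exchange1 by auto
qed


section \<open>The syntactic model\<close>

text \<open>The unit laws of a Q-structure are equations, whereas \<open>Tensor One A\<close> and
  \<open>A\<close> are only interderivable.\<close>

definition unital_tensor :: "'a fm \<Rightarrow> 'a fm \<Rightarrow> 'a fm" where
  "unital_tensor A B = (if A = One then B else if B = One then A else Tensor A B)"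

lemma unital_tensor_One [simp]: "unital_tensor One A = A" "unital_tensor A One = A"
  by (simp_all add: unital_tensor_def)

text \<open>Invertibility of \<open>Par\<close> and of \<open>NegOne\<close> makes the case
  distinction on \<open>One\<close> invisible to derivability, so orthogonality becomes a
  two-formula sequent.\<close>

lemma derivable_neg_unital_tensor:
  "derivable [neg (unital_tensor A B)] \<longleftrightarrow> derivable [neg A, neg B]"
  by (auto simp: unital_tensor_def derivable_Par derivable_NegOne
      derivable_pair_commute[of _ NegOne])

text \<open>If a factor is \<open>One\<close>, the matching hypothesis derives its target outright,
  and the tensor rule applies with that side vacant.\<close>

lemma unital_tensor_mono:
  assumes "derivable [neg a, A]" "derivable [neg b, B]"
  shows "derivable [neg (unital_tensor a b), Tensor A B]"
proof -
  have "derivable [neg b, Tensor A B]" if "a = One"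
    using TensorR[of A "[]" B "[neg b]"] assms Exchange1[OF assms(2)] that
    by (simp add: derivable_NegOne)
  moreover have "derivable [neg a, Tensor A B]" if "b = One"
    using TensorR[of A "[neg a]" B "[]"] assms Exchange1[OF assms(1)] that
    by (simp add: derivable_NegOne)
  ultimately show ?thesis
    using Tensor_mono[OF assms] by (auto simp: unital_tensor_def)
qed

lemma neg_unital_tensor_commute:
  "derivable [neg (unital_tensor A B)] \<longleftrightarrow> derivable [neg (unital_tensor B A)]"
  by (simp add: derivable_neg_unital_tensor derivable_pair_commute)

lemma neg_unital_tensor_assoc:
  "derivable [neg (unital_tensor (unital_tensor A B) C)] \<longleftrightarrow>
   derivable [neg (unital_tensor A (unital_tensor C B))]"
proof (cases "A = One \<or> B = One \<or> C = One")
  case True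
  \<comment> \<open>For \<open>A = One\<close> the claim is commutativity of \<open>B\<close> and
    \<open>C\<close>; if \<open>B\<close> or \<open>C\<close> is \<open>One\<close>, both sides are
    the same formula.\<close>
  then show ?thesis using neg_unital_tensor_commute[of B C] by auto
next
  case False
  then have "derivable [neg (unital_tensor (unital_tensor A B) C)] \<longleftrightarrow>
      derivable [Par (neg A) (neg B), neg C]"
    by (simp add: derivable_neg_unital_tensor) (simp add: unital_tensor_def)
  also have "\<dots> \<longleftrightarrow> derivable [neg A, Par (neg C) (neg B)]"
    by (rule residuation_iff)
  also have "\<dots> \<longleftrightarrow> derivable [neg (unital_tensor A (unital_tensor C B))]"
    using False by (simp add: derivable_neg_unital_tensor) (simp add: unital_tensor_def)
  finally show ?thesis .
qed

text \<open>The weakening rule is what makes the model projective.\<close>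

lemma neg_unital_tensor_projective:
  assumes "derivable [neg A]"
  shows "derivable [neg (unital_tensor A B)]"
  unfolding derivable_neg_unital_tensor using assms by (rule WR)

section \<open>Countability of the formulas over finitely many letters\<close>

lemma set_fm_neg [simp]: "set_fm (neg A) = set_fm A"
  by (induction A) auto

instance fm :: (countable) countable
  by countable_datatype

text \<open>The letter type may be uncountable, but finitely many letters can be renamed injectively
  to natural numbers, and formulas over those are countable.\<close>

lemma countable_formulas:
  assumes "finite S"
  shows "\<exists>h :: 'a fm \<Rightarrow> nat. inj_on h {A. set_fm A \<subseteq> S}"
proof -
  obtain f :: "'a \<Rightarrow> nat" where f: "inj_on f S"
    using finite_imp_inj_to_nat_seg[OF assms] by blast
  have "inj_on (map_fm f) {A. set_fm A \<subseteq> S}"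
    by (rule inj_onI, rule fm.inj_map_strong) (use f in \<open>auto dest: inj_onD\<close>)
  then have "inj_on (to_nat \<circ> map_fm f) {A. set_fm A \<subseteq> S}"
    by (rule comp_inj_on) simp
  then show ?thesis by blast
qed

text \<open>The encoding \<open>e\<close> moves the model into the arbitrary infinite type \<open>'p\<close>.\<close>

locale syntactic_model =
  fixes S :: "'a set" and e :: "'a fm \<Rightarrow> 'p"
  assumes inj: "inj_on e {A. set_fm A \<subseteq> S}"
begin

section \<open>The Q-structure of encoded formulas\<close>

definition fms :: "'a fm set" where
  "fms = {A. set_fm A \<subseteq> S}"

definition dec :: "'p \<Rightarrow> 'a fm" where
  "dec = inv_into fms e"

definition M :: "'p qstruct" where
  "M = \<lparr>points = e ` fms, zeros = e ` {A \<in> fms. derivable [neg A]},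
        mul = (\<lambda>p q. e (unital_tensor (dec p) (dec q))), unit = e One\<rparr>"

text \<open>The principal down-set of \<open>A\<close> in the preorder of provable
  implication.\<close>

definition below :: "'a fm \<Rightarrow> 'a fm set" where
  "below A = {B \<in> fms. derivable [neg B, A]}"

text \<open>Letters outside \<open>S\<close> are not points of the model but still need a fact; the
  set of all points serves as default.\<close>

definition canonical :: "'a \<Rightarrow> 'p set" where
  "canonical a = (if a \<in> S then e ` below (Letter a) else e ` below Top)"

lemma dec_e [simp]: "A \<in> fms \<Longrightarrow> dec (e A) = A"
  using inj by (simp add: dec_def fms_def)

lemma e_eq_iff [simp]: "A \<in> fms \<Longrightarrow> B \<in> fms \<Longrightarrow> e A = e B \<longleftrightarrow> A = B"
  using inj by (simp add: fms_def inj_on_eq_iff)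

lemma fms_simps [simp]:
  "One \<in> fms" "NegOne \<in> fms" "Top \<in> fms" "NegTop \<in> fms"
  "Letter a \<in> fms \<longleftrightarrow> a \<in> S" "NegLetter a \<in> fms \<longleftrightarrow> a \<in> S"
  "Tensor A B \<in> fms \<longleftrightarrow> A \<in> fms \<and> B \<in> fms" "Par A B \<in> fms \<longleftrightarrow> A \<in> fms \<and> B \<in> fms"
  "With A B \<in> fms \<longleftrightarrow> A \<in> fms \<and> B \<in> fms" "Plus A B \<in> fms \<longleftrightarrow> A \<in> fms \<and> B \<in> fms"
  "neg A \<in> fms \<longleftrightarrow> A \<in> fms"
  by (auto simp: fms_def)

lemma unital_tensor_fms [simp]: "A \<in> fms \<Longrightarrow> B \<in> fms \<Longrightarrow> unital_tensor A B \<in> fms"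
  by (simp add: unital_tensor_def)

lemma zeros_M: "A \<in> fms \<Longrightarrow> e A \<in> zeros M \<longleftrightarrow> derivable [neg A]"
  by (auto simp: M_def)

lemma mul_M: "A \<in> fms \<Longrightarrow> B \<in> fms \<Longrightarrow> mul M (e A) (e B) = e (unital_tensor A B)"
  by (simp add: M_def)

lemma points_M: "points M = e ` fms"
  by (simp add: M_def)

lemma unit_M: "unit M = e One"
  by (simp add: M_def)

lemma projective_M: "projective_Q_structure M"
proof
  show "zeros M \<subseteq> points M" by (auto simp: M_def)
  show "unit M \<in> points M" by (simp add: M_def)
next
  fix x y assume "x \<in> points M" "y \<in> points M"
  then show "mul M x y \<in> points M" "mul M x y \<in> zeros M \<longleftrightarrow> mul M y x \<in> zeros M"
    by (auto simp: points_M mul_M zeros_M derivable_neg_unital_tensor Exchange1)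
next
  fix x y z assume "x \<in> points M" "y \<in> points M" "z \<in> points M"
  then obtain A B C where "A \<in> fms" "B \<in> fms" "C \<in> fms" "x = e A" "y = e B" "z = e C"
    by (auto simp: points_M)
  then show "mul M (mul M x y) z \<in> zeros M \<longleftrightarrow> mul M x (mul M z y) \<in> zeros M"
    by (simp add: mul_M zeros_M neg_unital_tensor_assoc[of A B C])
next
  fix x assume "x \<in> points M"
  then show "mul M (unit M) x = x" "mul M x (unit M) = x"
    by (auto simp: points_M mul_M unit_M)
next
  fix x y assume "x \<in> zeros M" "y \<in> points M"
  moreover from this obtain A where "A \<in> fms" "x = e A"
    by (auto simp: M_def)
  ultimately show "mul M x y \<in> zeros M"
    using neg_unital_tensor_projective by (auto simp: points_M mul_M zeros_M)
qed

sublocale projective_Q_structure M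
  by (rule projective_M)

lemma perp_M:
  assumes "U \<subseteq> fms"
  shows "perp M (e ` U) = e ` {B \<in> fms. \<forall>u \<in> U. derivable [neg B, neg u]}"
proof -
  have "e B \<in> perp M (e ` U) \<longleftrightarrow> (\<forall>u \<in> U. derivable [neg B, neg u])" if "B \<in> fms" for B
    using that assms
    by (auto simp: perp_def points_M mul_M zeros_M subset_iff derivable_neg_unital_tensor)
  then show ?thesis
    using perp_subset[of "e ` U"] by (auto simp: points_M)
qed

lemma set_mul_M:
  assumes "U \<subseteq> fms" "W \<subseteq> fms"
  shows "set_mul M (e ` U) (e ` W) = e ` {unital_tensor a b | a b. a \<in> U \<and> b \<in> W}"
proof -
  have "mul M (e a) (e b) = e (unital_tensor a b)" if "a \<in> U" "b \<in> W" for a b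
    using assms that by (intro mul_M) auto
  note [simp] = this
  show ?thesis
  proof (intro equalityI subsetI)
    fix x assume "x \<in> set_mul M (e ` U) (e ` W)"
    then obtain a b where "a \<in> U" "b \<in> W" "x = mul M (e a) (e b)"
      by (auto simp: set_mul_def)
    then show "x \<in> e ` {unital_tensor a b | a b. a \<in> U \<and> b \<in> W}" by auto
  next
    fix x assume "x \<in> e ` {unital_tensor a b | a b. a \<in> U \<and> b \<in> W}"
    then obtain a b where "a \<in> U" "b \<in> W" "x = mul M (e a) (e b)" by auto
    then show "x \<in> set_mul M (e ` U) (e ` W)"
      unfolding set_mul_def by blast
  qed
qed

section \<open>Principal down-sets and the operations on facts\<close>

lemma below_subset: "below A \<subseteq> fms"
  by (auto simp: below_def)

text \<open>By the logical axiom \<open>A\<close> is itself the greatest element of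
  \<open>below A\<close>, so orthogonality to the whole set reduces by cut to orthogonality to
  \<open>A\<close>.\<close>

lemma perp_below:
  assumes "A \<in> fms"
  shows "perp M (e ` below A) = e ` below (neg A)"
proof -
  have "(\<forall>u \<in> below A. derivable [neg B, neg u]) \<longleftrightarrow> derivable [neg B, neg A]" for B
  proof
    assume "\<forall>u \<in> below A. derivable [neg B, neg u]"
    then show "derivable [neg B, neg A]"
      using assms Logical by (auto simp: below_def)
  next
    assume "derivable [neg B, neg A]"
    then show "\<forall>u \<in> below A. derivable [neg B, neg u]"
      using derivable_trans[of "neg B" "neg A"] Exchange1 by (fastforce simp: below_def)
  qed
  then show ?thesis
    by (simp add: perp_M below_subset) (simp add: below_def)
qed

lemma below_points:
  assumes "\<And>B. derivable [neg B, A]"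
  shows "e ` below A = points M"
  using assms by (simp add: below_def points_M)

lemma below_Top: "e ` below Top = points M"
  by (intro below_points Exchange1[OF TopR]) simp

text \<open>Weakening lets every formula imply \<open>One\<close>. This matches
  \<open>perp_zeros\<close>, where projectivity makes every point orthogonal to all zeros.\<close>

lemma below_One: "e ` below One = points M"
  by (intro below_points Exchange1[OF WR[OF OneR]])

lemma below_With: "e ` below (With A B) = e ` below A \<inter> e ` below B"
proof -
  have "e ` below A \<inter> e ` below B = e ` (below A \<inter> below B)"
    by (rule inj_on_image_Int[symmetric, OF inj]) (auto simp: below_def fms_def)
  then show ?thesis by (auto simp: below_def derivable_With)
qed

text \<open>Up to interderivability \<open>Tensor A B\<close> is the greatest product of elements of
  the two down-sets, so orthogonality need only be tested there.\<close>

lemma perp_set_mul_below: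
  assumes A: "A \<in> fms" and B: "B \<in> fms"
  shows "perp M (set_mul M (e ` below A) (e ` below B)) = e ` below (neg (Tensor A B))"
proof -
  let ?U = "{unital_tensor a b | a b. a \<in> below A \<and> b \<in> below B}"
  have "set_mul M (e ` below A) (e ` below B) = e ` ?U"
    by (rule set_mul_M[OF below_subset below_subset])
  moreover have "?U \<subseteq> fms"
    by (auto simp: below_def)
  moreover have "(\<forall>u \<in> ?U. derivable [neg C, neg u]) \<longleftrightarrow> derivable [neg C, neg (Tensor A B)]" for C
  proof
    assume *: "\<forall>u \<in> ?U. derivable [neg C, neg u]"
    have equiv: "derivable [neg A, With A A]" "derivable [neg (With A A), A]" for A :: "'a fm"
      using Logical[of A] Plus1[OF Logical, of A] by (simp_all add: derivable_With)
    \<comment> \<open>The product of \<open>A\<close> and \<open>B\<close> is not literally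
      \<open>Tensor A B\<close> when one of them is \<open>One\<close>. The equivalents
      \<open>With A A\<close> and \<open>With B B\<close> are never \<open>One\<close>, so their
      product is a genuine tensor.\<close>
    have "Tensor (With A A) (With B B) \<in> ?U"
    proof -
      have "Tensor (With A A) (With B B) = unital_tensor (With A A) (With B B)"
        by (simp add: unital_tensor_def)
      moreover have "With A A \<in> below A" "With B B \<in> below B"
        using equiv(2) A B by (simp_all add: below_def del: neg.simps)
      ultimately show ?thesis by blast
    qed
    then have "derivable [neg C, neg (Tensor (With A A) (With B B))]"
      using * by blast
    moreover have "derivable [Par (neg A) (neg B), Tensor (With A A) (With B B)]"
      using equiv by (intro Tensor_mono)
    from Exchange1[OF this]
    have "derivable [neg (neg (Tensor (With A A) (With B B))), neg (Tensor A B)]"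
      by simp
    ultimately show "derivable [neg C, neg (Tensor A B)]"
      by (rule derivable_trans)
  next
    assume *: "derivable [neg C, neg (Tensor A B)]"
    have "derivable [neg C, neg (unital_tensor a b)]" if "a \<in> below A" "b \<in> below B" for a b
    proof (rule derivable_trans[OF *])
      show "derivable [neg (neg (Tensor A B)), neg (unital_tensor a b)]"
        unfolding neg_neg using that
        by (intro Exchange1[OF unital_tensor_mono]) (auto simp: below_def)
    qed
    then show "\<forall>u \<in> ?U. derivable [neg C, neg u]" by blast
  qed
  ultimately show ?thesis
    by (simp only: perp_M) (simp add: below_def)
qed

lemma is_fact_below: "A \<in> fms \<Longrightarrow> is_fact M (e ` below A)"
  using below_subset by (auto simp: is_fact_def perp_below points_M)

section \<open>The canonical assignment and its truth lemma\<close>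

lemma assignment_canonical: "assignment M canonical"
  by (simp add: assignment_def canonical_def is_fact_below)

lemma perp_zeros: "perp M (zeros M) = points M"
proof -
  have "mul M p z \<in> zeros M" if "p \<in> points M" "z \<in> zeros M" for p z
    using that projective[of z p] zeros_commute[of p z] zeros_subset by blast
  then show ?thesis by (auto simp: perp_def)
qed

lemma perp_points: "perp M (points M) = e ` below NegOne"
  using perp_below[of One] by (simp add: below_One)

text \<open>The truth lemma. \<open>Tensor\<close> and \<open>Par\<close> reduce to the
  \<open>perp\<close> of a product of down-sets; \<open>Plus\<close> reduces to \<open>With\<close>,
  since the \<open>perp\<close> of a union is an intersection.\<close>

lemma interp_canonical: "A \<in> fms \<Longrightarrow> interp M canonical A = e ` below A"
proof (induction A)
  case (Letter a)
  then show ?case by (simp add: canonical_def)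
next
  case (NegLetter a)
  then show ?case by (simp add: canonical_def perp_below)
next
  case One
  then show ?case by (simp add: perp_zeros below_One)
next
  case NegOne
  then show ?case by (simp add: perp_zeros perp_points)
next
  case Top
  then show ?case by (simp add: below_Top)
next
  case NegTop
  then show ?case using perp_below[of Top] by (simp add: below_Top)
next
  case (Tensor A B)
  then show ?case
    using perp_below[of "neg (Tensor A B)"]
    by (simp add: tensor_fact_def perp_set_mul_below)
next
  case (Par A B)
  then show ?case
    using perp_set_mul_below[of "neg A" "neg B"] by (simp add: par_fact_def perp_below)
next
  case (With A B)
  then show ?case by (simp add: with_fact_def below_With)
next
  case (Plus A B)
  have "perp M (e ` below A \<union> e ` below B) = e ` below (neg (Plus A B))"
    using Plus.prems by (simp add: perp_Un perp_below below_With)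
  then show ?case
    using Plus perp_below[of "neg (Plus A B)"] by (simp add: plus_fact_def)
qed

text \<open>That \<open>One\<close> is below \<open>A\<close> means \<open>[NegOne, A]\<close> is
  derivable, and \<open>NegOne\<close> can be cut away.\<close>

lemma unit_in_canonical_iff:
  assumes "A \<in> fms"
  shows "unit M \<in> interp M canonical A \<longleftrightarrow> derivable [A]"
proof -
  have "e One \<in> e ` below A \<longleftrightarrow> One \<in> below A"
    using below_subset by (auto simp: subset_iff)
  then show ?thesis
    using assms by (simp add: interp_canonical unit_M below_def derivable_NegOne)
qed

end

theorem theorem3:
  shows
    "(\<forall>(\<Gamma> :: 'a fm list) (Q :: 'p qstruct) V.
        derivable \<Gamma> \<longrightarrow> projective_Q_structure Q \<longrightarrow> assignment Q V \<longrightarrow> valid Q V \<Gamma>) \<and>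
     (infinite (UNIV :: 'p set) \<longrightarrow>
      (\<forall>x :: 'a fm.
         (\<forall>(Q :: 'p qstruct) V.
            projective_Q_structure Q \<longrightarrow> assignment Q V \<longrightarrow> unit Q \<in> interp Q V x) \<longrightarrow>
         derivable [x]))"
proof (intro conjI allI impI)
  fix \<Gamma> :: "'a fm list" and Q :: "'p qstruct" and V :: "'a \<Rightarrow> 'p set"
  assume "derivable \<Gamma>" "projective_Q_structure Q" "assignment Q V"
  then show "valid Q V \<Gamma>"
    by (intro projective_Q_structure.soundness)
next
  fix x :: "'a fm"
  assume inf: "infinite (UNIV :: 'p set)"
    and x: "\<forall>(Q :: 'p qstruct) V.
      projective_Q_structure Q \<longrightarrow> assignment Q V \<longrightarrow> unit Q \<in> interp Q V x"
  \<comment> \<open>Restricting the model to the letters of \<open>x\<close> makes its points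
    countable, so they embed through the natural numbers into any infinite point type.\<close>
  have "finite (set_fm x)" by (induction x) auto
  then obtain h :: "'a fm \<Rightarrow> nat" where h: "inj_on h {A. set_fm A \<subseteq> set_fm x}"
    using countable_formulas by blast
  obtain g :: "nat \<Rightarrow> 'p" where g: "inj g"
    using infinite_countable_subset[OF inf] by blast
  interpret syntactic_model "set_fm x" "g \<circ> h"
    by standard (rule comp_inj_on[OF h inj_on_subset[OF g]], simp)
  have "x \<in> fms" by (simp add: fms_def)
  then show "derivable [x]"
    using x projective_M assignment_canonical unit_in_canonical_iff by blast
qed

end
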